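(* The algebra $\mathcal{O}(\mathrm{Aut}^+(\mathrm{O}^-(6,2)))$ is commutative. Therefore, the Schläfli graph has no quantum symmetry, i.e. $\mathcal{O}(\mathrm{Aut}^+(Y))$ is commutative for $Y$ the Schläfli graph.
   Context: For a finite simple graph $X$ on $N$ vertices with adjacency matrix $A$, $\mathcal{O}(\mathrm{Aut}^+(X))$ is the universal unital $*$-algebra generated by projections $u_{ij}$ ($0\le i,j<N$) such that projections in the same row or the same column of $u=(u_{ij})$ are orthogonal, every row and column of $u$ sums to $1$, and $Au=uA$. The graph $X$ has no quantum symmetry if $\mathcal{O}(\mathrm{Aut}^+(X))$ is commutative. The graph $\mathrm{O}^-(6,2)$: let $Q_e(v_0,v_1)=v_0^2+v_0v_1+v_1^2$ (an anisotropic quadratic form on $\mathbb{F}_2^2$) and $Q(v)=v_0v_1+v_2v_3+Q_e(v_4,v_5)$ on $\mathbb{F}_2^6$. The vertices are the points $\langle v\rangle$ of $\mathbb{P}^5(\mathbb{F}_2)$ with $Q(v)=0$, and two distinct vertices $\langle v\rangle,\langle w\rangle$ are adjacent iff $Q(v+w)=0$. It is strongly regular with parameters $(27,10,1,5)$, and the Schläfli graph is its complement. *)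

theory Defs
  imports
    "HOL-Analysis.Cartesian_Space"
    "HOL-Library.Z2"
    "HOL-Library.Numeral_Type"
    "HOL-Algebra.Module"
    "Graph_Theory.Pair_Digraph"
begin

section \<open>Unital complex *-algebras\<close>

record 'b star_alg = "(complex, 'b) module" +
  invol :: "'b \<Rightarrow> 'b"

locale star_algebra = ring A for A :: "('b, 'm) star_alg_scheme" (structure) +
  assumes scale_closed: "x \<in> carrier A \<Longrightarrow> c \<odot> x \<in> carrier A"
    and scale_one: "x \<in> carrier A \<Longrightarrow> 1 \<odot> x = x"
    and scale_scale: "x \<in> carrier A \<Longrightarrow> (c * d) \<odot> x = c \<odot> (d \<odot> x)"
    and scale_add_left: "x \<in> carrier A \<Longrightarrow> (c + d) \<odot> x = c \<odot> x \<oplus> d \<odot> x"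
    and scale_add_right:
      "\<lbrakk>x \<in> carrier A; y \<in> carrier A\<rbrakk> \<Longrightarrow> c \<odot> (x \<oplus> y) = c \<odot> x \<oplus> c \<odot> y"
    and scale_mult_left:
      "\<lbrakk>x \<in> carrier A; y \<in> carrier A\<rbrakk> \<Longrightarrow> c \<odot> (x \<otimes> y) = (c \<odot> x) \<otimes> y"
    and scale_mult_right:
      "\<lbrakk>x \<in> carrier A; y \<in> carrier A\<rbrakk> \<Longrightarrow> c \<odot> (x \<otimes> y) = x \<otimes> (c \<odot> y)"
    and invol_closed: "x \<in> carrier A \<Longrightarrow> invol A x \<in> carrier A"
    and invol_invol: "x \<in> carrier A \<Longrightarrow> invol A (invol A x) = x"
    and invol_add:
      "\<lbrakk>x \<in> carrier A; y \<in> carrier A\<rbrakk> \<Longrightarrow> invol A (x \<oplus> y) = invol A x \<oplus> invol A y"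
    and invol_mult:
      "\<lbrakk>x \<in> carrier A; y \<in> carrier A\<rbrakk> \<Longrightarrow> invol A (x \<otimes> y) = invol A y \<otimes> invol A x"
    and invol_scale: "x \<in> carrier A \<Longrightarrow> invol A (c \<odot> x) = cnj c \<odot> invol A x"

definition star_hom ::
  "('a, 'm) star_alg_scheme \<Rightarrow> ('b, 'n) star_alg_scheme \<Rightarrow> ('a \<Rightarrow> 'b) set" where
  "star_hom A B = {h \<in> ring_hom A B.
     (\<forall>c. \<forall>x\<in>carrier A. h (c \<odot>\<^bsub>A\<^esub> x) = c \<odot>\<^bsub>B\<^esub> h x) \<and>
     (\<forall>x\<in>carrier A. h (invol A x) = invol B (h x))}"

definition commutative_alg :: "('b, 'm) star_alg_scheme \<Rightarrow> bool" where
  "commutative_alg A \<longleftrightarrow> (\<forall>x\<in>carrier A. \<forall>y\<in>carrier A. x \<otimes>\<^bsub>A\<^esub> y = y \<otimes>\<^bsub>A\<^esub> x)"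


section \<open>Unital *-algebras given by generators and relations\<close>

text \<open>
  The universal unital *-algebra with generators \<open>G\<close> and relations \<open>R\<close> is realised as the set of
  formal *-algebra expressions over \<open>G\<close> modulo the least congruence containing \<open>R\<close> and the axioms
  of unital complex *-algebras.
\<close>

datatype (gens: 'g) sterm =
    Gen 'g
  | Zero
  | One
  | Add "'g sterm" "'g sterm"
  | Mult "'g sterm" "'g sterm"
  | Scale complex "'g sterm"
  | Star "'g sterm"

definition terms_over :: "'g set \<Rightarrow> 'g sterm set" where
  "terms_over G = {t. gens t \<subseteq> G}"

definition sum_term :: "'g sterm list \<Rightarrow> 'g sterm" where
  "sum_term ts = foldr Add ts Zero"

inductive_set star_cong :: "'g set \<Rightarrow> 'g sterm rel \<Rightarrow> 'g sterm rel"
  for G :: "'g set" and R :: "'g sterm rel" where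
  relation: "\<lbrakk>(s, t) \<in> R; s \<in> terms_over G; t \<in> terms_over G\<rbrakk> \<Longrightarrow> (s, t) \<in> star_cong G R"
| refl: "t \<in> terms_over G \<Longrightarrow> (t, t) \<in> star_cong G R"
| sym: "(s, t) \<in> star_cong G R \<Longrightarrow> (t, s) \<in> star_cong G R"
| trans: "\<lbrakk>(r, s) \<in> star_cong G R; (s, t) \<in> star_cong G R\<rbrakk> \<Longrightarrow> (r, t) \<in> star_cong G R"
| Add: "\<lbrakk>(s, s') \<in> star_cong G R; (t, t') \<in> star_cong G R\<rbrakk>
    \<Longrightarrow> (Add s t, Add s' t') \<in> star_cong G R"
| Mult: "\<lbrakk>(s, s') \<in> star_cong G R; (t, t') \<in> star_cong G R\<rbrakk>
    \<Longrightarrow> (Mult s t, Mult s' t') \<in> star_cong G R"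
| Scale: "(s, s') \<in> star_cong G R \<Longrightarrow> (Scale c s, Scale c s') \<in> star_cong G R"
| Star: "(s, s') \<in> star_cong G R \<Longrightarrow> (Star s, Star s') \<in> star_cong G R"
| add_assoc: "\<lbrakk>r \<in> terms_over G; s \<in> terms_over G; t \<in> terms_over G\<rbrakk>
    \<Longrightarrow> (Add (Add r s) t, Add r (Add s t)) \<in> star_cong G R"
| add_comm: "\<lbrakk>s \<in> terms_over G; t \<in> terms_over G\<rbrakk> \<Longrightarrow> (Add s t, Add t s) \<in> star_cong G R"
| add_zero: "t \<in> terms_over G \<Longrightarrow> (Add Zero t, t) \<in> star_cong G R"
| add_inverse: "t \<in> terms_over G \<Longrightarrow> (Add (Scale (- 1) t) t, Zero) \<in> star_cong G R"
| mult_assoc: "\<lbrakk>r \<in> terms_over G; s \<in> terms_over G; t \<in> terms_over G\<rbrakk>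
    \<Longrightarrow> (Mult (Mult r s) t, Mult r (Mult s t)) \<in> star_cong G R"
| one_mult: "t \<in> terms_over G \<Longrightarrow> (Mult One t, t) \<in> star_cong G R"
| mult_one: "t \<in> terms_over G \<Longrightarrow> (Mult t One, t) \<in> star_cong G R"
| distrib_right: "\<lbrakk>r \<in> terms_over G; s \<in> terms_over G; t \<in> terms_over G\<rbrakk>
    \<Longrightarrow> (Mult (Add r s) t, Add (Mult r t) (Mult s t)) \<in> star_cong G R"
| distrib_left: "\<lbrakk>r \<in> terms_over G; s \<in> terms_over G; t \<in> terms_over G\<rbrakk>
    \<Longrightarrow> (Mult t (Add r s), Add (Mult t r) (Mult t s)) \<in> star_cong G R"
| scale_one: "t \<in> terms_over G \<Longrightarrow> (Scale 1 t, t) \<in> star_cong G R"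
| scale_scale: "t \<in> terms_over G \<Longrightarrow> (Scale (c * d) t, Scale c (Scale d t)) \<in> star_cong G R"
| scale_add_left: "t \<in> terms_over G
    \<Longrightarrow> (Scale (c + d) t, Add (Scale c t) (Scale d t)) \<in> star_cong G R"
| scale_add_right: "\<lbrakk>s \<in> terms_over G; t \<in> terms_over G\<rbrakk>
    \<Longrightarrow> (Scale c (Add s t), Add (Scale c s) (Scale c t)) \<in> star_cong G R"
| scale_mult_left: "\<lbrakk>s \<in> terms_over G; t \<in> terms_over G\<rbrakk>
    \<Longrightarrow> (Scale c (Mult s t), Mult (Scale c s) t) \<in> star_cong G R"
| scale_mult_right: "\<lbrakk>s \<in> terms_over G; t \<in> terms_over G\<rbrakk>
    \<Longrightarrow> (Scale c (Mult s t), Mult s (Scale c t)) \<in> star_cong G R"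
| star_star: "t \<in> terms_over G \<Longrightarrow> (Star (Star t), t) \<in> star_cong G R"
| star_add: "\<lbrakk>s \<in> terms_over G; t \<in> terms_over G\<rbrakk>
    \<Longrightarrow> (Star (Add s t), Add (Star s) (Star t)) \<in> star_cong G R"
| star_mult: "\<lbrakk>s \<in> terms_over G; t \<in> terms_over G\<rbrakk>
    \<Longrightarrow> (Star (Mult s t), Mult (Star t) (Star s)) \<in> star_cong G R"
| star_scale: "t \<in> terms_over G \<Longrightarrow> (Star (Scale c t), Scale (cnj c) (Star t)) \<in> star_cong G R"

definition universal_star_algebra :: "'g set \<Rightarrow> 'g sterm rel \<Rightarrow> 'g sterm set star_alg" where
  "universal_star_algebra G R =
    \<lparr> carrier = terms_over G // star_cong G R,
      monoid.mult = (\<lambda>X Y. \<Union>x\<in>X. \<Union>y\<in>Y. star_cong G R `` {Mult x y}),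
      one = star_cong G R `` {One},
      zero = star_cong G R `` {Zero},
      add = (\<lambda>X Y. \<Union>x\<in>X. \<Union>y\<in>Y. star_cong G R `` {Add x y}),
      smult = (\<lambda>c X. \<Union>x\<in>X. star_cong G R `` {Scale c x}),
      invol = (\<lambda>X. \<Union>x\<in>X. star_cong G R `` {Star x}) \<rparr>"


lemma terms_over_simps [simp]:
  "Gen g \<in> terms_over G \<longleftrightarrow> g \<in> G"
  "Zero \<in> terms_over G"
  "One \<in> terms_over G"
  "Add s t \<in> terms_over G \<longleftrightarrow> s \<in> terms_over G \<and> t \<in> terms_over G"
  "Mult s t \<in> terms_over G \<longleftrightarrow> s \<in> terms_over G \<and> t \<in> terms_over G"
  "Scale c t \<in> terms_over G \<longleftrightarrow> t \<in> terms_over G"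
  "Star t \<in> terms_over G \<longleftrightarrow> t \<in> terms_over G"
  by (auto simp: terms_over_def)

lemma star_cong_terms: "(s, t) \<in> star_cong G R \<Longrightarrow> s \<in> terms_over G \<and> t \<in> terms_over G"
  by (induction rule: star_cong.induct) auto

lemma equiv_star_cong: "equiv (terms_over G) (star_cong G R)"
proof (rule equivI)
  show "star_cong G R \<subseteq> terms_over G \<times> terms_over G"
    using star_cong_terms by fastforce
  show "refl_on (terms_over G) (star_cong G R)"
    by (auto intro!: refl_onI star_cong.refl)
  show "sym (star_cong G R)" by (auto intro: symI star_cong.sym)
  show "trans (star_cong G R)" by (auto intro: transI star_cong.trans)
qed

definition star_class :: "'g set \<Rightarrow> 'g sterm rel \<Rightarrow> 'g sterm \<Rightarrow> 'g sterm set" where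
  "star_class G R t = star_cong G R `` {t}"

lemma star_class_eq_iff:
  "\<lbrakk>s \<in> terms_over G; t \<in> terms_over G\<rbrakk>
    \<Longrightarrow> star_class G R s = star_class G R t \<longleftrightarrow> (s, t) \<in> star_cong G R"
  unfolding star_class_def by (rule eq_equiv_class_iff[OF equiv_star_cong])

lemma star_class_eqI: "(s, t) \<in> star_cong G R \<Longrightarrow> star_class G R s = star_class G R t"
  unfolding star_class_def by (rule equiv_class_eq[OF equiv_star_cong])

context
  fixes G :: "'g set" and R :: "'g sterm rel"
begin

private abbreviation (input) "U \<equiv> universal_star_algebra G R"
private abbreviation (input) "cl \<equiv> star_class G R"

lemma usa_carrier: "carrier U = cl ` terms_over G"
  by (auto simp: universal_star_algebra_def quotient_def star_class_def)

lemma usa_closed: "t \<in> terms_over G \<Longrightarrow> cl t \<in> carrier U"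
  by (simp add: usa_carrier)

lemma usa_one: "\<one>\<^bsub>U\<^esub> = cl One"
  and usa_zero: "\<zero>\<^bsub>U\<^esub> = cl Zero"
  by (auto simp: universal_star_algebra_def star_class_def)

lemma usa_mult:
  assumes "s \<in> terms_over G" "t \<in> terms_over G"
  shows "cl s \<otimes>\<^bsub>U\<^esub> cl t = cl (Mult s t)"
proof -
  have "congruent2 (star_cong G R) (star_cong G R) (\<lambda>x y. star_cong G R `` {Mult x y})"
    by (auto intro!: congruent2I' equiv_class_eq[OF equiv_star_cong] star_cong.Mult)
  from UN_equiv_class2[OF equiv_star_cong equiv_star_cong this assms]
  show ?thesis by (simp add: universal_star_algebra_def star_class_def)
qed

lemma usa_add:
  assumes "s \<in> terms_over G" "t \<in> terms_over G"
  shows "cl s \<oplus>\<^bsub>U\<^esub> cl t = cl (Add s t)"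
proof -
  have "congruent2 (star_cong G R) (star_cong G R) (\<lambda>x y. star_cong G R `` {Add x y})"
    by (auto intro!: congruent2I' equiv_class_eq[OF equiv_star_cong] star_cong.Add)
  from UN_equiv_class2[OF equiv_star_cong equiv_star_cong this assms]
  show ?thesis by (simp add: universal_star_algebra_def star_class_def)
qed

lemma usa_scale:
  assumes "t \<in> terms_over G"
  shows "c \<odot>\<^bsub>U\<^esub> cl t = cl (Scale c t)"
proof -
  have "congruent (star_cong G R) (\<lambda>x. star_cong G R `` {Scale c x})"
    by (auto intro!: congruentI equiv_class_eq[OF equiv_star_cong] star_cong.Scale)
  from UN_equiv_class[OF equiv_star_cong this assms]
  show ?thesis by (simp add: universal_star_algebra_def star_class_def)
qed

lemma usa_star:
  assumes "t \<in> terms_over G"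
  shows "invol U (cl t) = cl (Star t)"
proof -
  have "congruent (star_cong G R) (\<lambda>x. star_cong G R `` {Star x})"
    by (auto intro!: congruentI equiv_class_eq[OF equiv_star_cong] star_cong.Star)
  from UN_equiv_class[OF equiv_star_cong this assms]
  show ?thesis by (simp add: universal_star_algebra_def star_class_def)
qed

lemmas star_class_axioms =
  star_cong.add_assoc[THEN star_class_eqI]
  star_cong.add_zero[THEN star_class_eqI] star_cong.add_inverse[THEN star_class_eqI]
  star_cong.mult_assoc[THEN star_class_eqI] star_cong.one_mult[THEN star_class_eqI]
  star_cong.mult_one[THEN star_class_eqI] star_cong.distrib_left[THEN star_class_eqI]
  star_cong.distrib_right[THEN star_class_eqI] star_cong.scale_one[THEN star_class_eqI]
  star_cong.scale_scale[THEN star_class_eqI] star_cong.scale_add_left[THEN star_class_eqI]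
  star_cong.scale_add_right[THEN star_class_eqI]
  star_cong.scale_mult_left[THEN star_class_eqI, symmetric]
  star_cong.scale_mult_right[THEN star_class_eqI, symmetric]
  star_cong.star_star[THEN star_class_eqI] star_cong.star_add[THEN star_class_eqI]
  star_cong.star_mult[THEN star_class_eqI] star_cong.star_scale[THEN star_class_eqI]

lemmas usa_ops = usa_one usa_zero usa_mult usa_add usa_scale usa_star

lemma usa_ring: "ring U"
proof (rule ringI)
  show "abelian_group U"
  proof (rule abelian_groupI)
    fix x assume "x \<in> carrier U"
    then obtain t where t: "t \<in> terms_over G" "x = cl t" by (auto simp: usa_carrier)
    then show "\<exists>y\<in>carrier U. y \<oplus>\<^bsub>U\<^esub> x = \<zero>\<^bsub>U\<^esub>"
      by (intro bexI[of _ "cl (Scale (- 1) t)"])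
        (simp_all add: usa_ops usa_closed star_cong.add_inverse[THEN star_class_eqI])
  next
    fix x y assume "x \<in> carrier U" "y \<in> carrier U"
    then obtain s t where "s \<in> terms_over G" "x = cl s" "t \<in> terms_over G" "y = cl t"
      by (auto simp: usa_carrier)
    then show "x \<oplus>\<^bsub>U\<^esub> y = y \<oplus>\<^bsub>U\<^esub> x"
      by (simp add: usa_add star_cong.add_comm[THEN star_class_eqI])
  qed (auto simp: usa_carrier usa_ops star_class_axioms)
  show "monoid U"
    by (rule monoidI) (auto simp: usa_carrier usa_ops star_class_axioms)
qed (auto simp: usa_carrier usa_ops star_class_axioms)

lemma usa_star_algebra: "star_algebra U"
  by (intro star_algebra.intro star_algebra_axioms.intro usa_ring)
    (auto simp: usa_carrier usa_ops star_class_axioms)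

lemma usa_sum_term:
  assumes "distinct xs" "\<And>x. x \<in> set xs \<Longrightarrow> f x \<in> terms_over G"
  shows "sum_term (map f xs) \<in> terms_over G"
    and "cl (sum_term (map f xs)) = finsum U (\<lambda>x. cl (f x)) (set xs)"
proof -
  interpret ring U by (rule usa_ring)
  have "sum_term (map f xs) \<in> terms_over G \<and>
      cl (sum_term (map f xs)) = finsum U (\<lambda>x. cl (f x)) (set xs)"
    using assms
  proof (induction xs)
    case Nil
    then show ?case by (simp add: sum_term_def usa_zero)
  next
    case (Cons a xs)
    then have "sum_term (map f xs) \<in> terms_over G"
      and "cl (sum_term (map f xs)) = finsum U (\<lambda>x. cl (f x)) (set xs)" by auto
    moreover have "finsum U (\<lambda>x. cl (f x)) (set (a # xs))
        = cl (f a) \<oplus>\<^bsub>U\<^esub> finsum U (\<lambda>x. cl (f x)) (set xs)"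
      using Cons.prems by (simp add: finsum_insert Pi_def usa_closed)
    moreover have "cl (Add (f a) (sum_term (map f xs))) = cl (f a) \<oplus>\<^bsub>U\<^esub> cl (sum_term (map f xs))"
      using Cons.prems calculation(1) by (simp add: usa_add)
    moreover have "sum_term (map f (a # xs)) = Add (f a) (sum_term (map f xs))"
      by (simp add: sum_term_def)
    ultimately show ?case using Cons.prems by simp
  qed
  then show "sum_term (map f xs) \<in> terms_over G"
    and "cl (sum_term (map f xs)) = finsum U (\<lambda>x. cl (f x)) (set xs)" by auto
qed

end

primrec eval_term :: "('b, 'm) star_alg_scheme \<Rightarrow> ('g \<Rightarrow> 'b) \<Rightarrow> 'g sterm \<Rightarrow> 'b" where
  "eval_term B f (Gen g) = f g"
| "eval_term B f Zero = \<zero>\<^bsub>B\<^esub>"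
| "eval_term B f One = \<one>\<^bsub>B\<^esub>"
| "eval_term B f (Add s t) = eval_term B f s \<oplus>\<^bsub>B\<^esub> eval_term B f t"
| "eval_term B f (Mult s t) = eval_term B f s \<otimes>\<^bsub>B\<^esub> eval_term B f t"
| "eval_term B f (Scale c t) = c \<odot>\<^bsub>B\<^esub> eval_term B f t"
| "eval_term B f (Star t) = invol B (eval_term B f t)"

context star_algebra
begin

lemma eval_closed:
  assumes f: "f \<in> G \<rightarrow> carrier A" and t: "t \<in> terms_over G"
  shows "eval_term A f t \<in> carrier A"
  using t by (induction t) (use f in \<open>auto simp: scale_closed invol_closed\<close>)

lemma eval_cong:
  assumes f: "f \<in> G \<rightarrow> carrier A"
    and R: "\<And>s t. (s, t) \<in> R \<Longrightarrow> eval_term A f s = eval_term A f t"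
    and st: "(s, t) \<in> star_cong G R"
  shows "eval_term A f s = eval_term A f t"
  using st
proof (induction rule: star_cong.induct)
  case (add_inverse t)
  then have x: "eval_term A f t \<in> carrier A" using eval_closed[OF f] by blast
  have "(0::complex) \<odot> eval_term A f t \<oplus> 0 \<odot> eval_term A f t = 0 \<odot> eval_term A f t"
    using scale_add_left[OF x, of 0 0] by simp
  then have "(0::complex) \<odot> eval_term A f t = \<zero>"
    using scale_closed[OF x] by (metis add.l_cancel_one)
  then show ?case
    using scale_add_left[OF x, of "- 1" 1] scale_one[OF x] by simp
next
  case (relation s t) then show ?case using R by blast
qed (simp_all add: eval_closed[OF f] a_ac m_assoc l_distr r_distr
    scale_one scale_scale scale_add_left scale_add_right
    scale_mult_left[symmetric] scale_mult_right[symmetric]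
    invol_invol invol_add invol_mult invol_scale)

lemma eval_sum_term:
  assumes "distinct xs" "\<And>x. x \<in> set xs \<Longrightarrow> eval_term A f (h x) \<in> carrier A"
  shows "eval_term A f (sum_term (map h xs)) = (\<Oplus>x\<in>set xs. eval_term A f (h x))"
  using assms by (induction xs) (auto simp: sum_term_def finsum_insert Pi_def)

end

theorem universal_property:
  fixes B :: "('b, 'm) star_alg_scheme"
  assumes B: "star_algebra B" and f: "f \<in> G \<rightarrow> carrier B"
    and R: "\<And>s t. (s, t) \<in> R \<Longrightarrow> eval_term B f s = eval_term B f t"
  shows "\<exists>h \<in> star_hom (universal_star_algebra G R) B. \<forall>g\<in>G. h (star_class G R (Gen g)) = f g"
    and "\<lbrakk>h \<in> star_hom (universal_star_algebra G R) B;
          h' \<in> star_hom (universal_star_algebra G R) B;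
          \<And>g. g \<in> G \<Longrightarrow> h (star_class G R (Gen g)) = h' (star_class G R (Gen g));
          x \<in> carrier (universal_star_algebra G R)\<rbrakk> \<Longrightarrow> h x = h' x"
proof -
  interpret B: star_algebra B by (rule B)
  let ?U = "universal_star_algebra G R"
  define h where "h X = eval_term B f (SOME t. t \<in> X)" for X
  have h: "h (star_class G R t) = eval_term B f t" if "t \<in> terms_over G" for t
  proof -
    have "t \<in> star_class G R t"
      using that by (simp add: star_class_def star_cong.refl)
    then have "(SOME s. s \<in> star_class G R t) \<in> star_class G R t" by (rule someI)
    then have "(t, SOME s. s \<in> star_class G R t) \<in> star_cong G R"
      by (simp add: star_class_def)
    from B.eval_cong[OF f R this] show ?thesis by (simp add: h_def)
  qed
  have "h \<in> star_hom ?U B"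
    unfolding star_hom_def ring_hom_def
    by (auto simp: usa_carrier usa_ops h B.eval_closed[OF f])
  then show "\<exists>h \<in> star_hom ?U B. \<forall>g\<in>G. h (star_class G R (Gen g)) = f g"
    by (intro bexI[of _ h]) (auto simp: h)
next
  interpret U: star_algebra "universal_star_algebra G R" by (rule usa_star_algebra)
  interpret B: star_algebra B by (rule B)
  let ?U = "universal_star_algebra G R"
  assume hom: "h \<in> star_hom ?U B" "h' \<in> star_hom ?U B"
    and gen: "\<And>g. g \<in> G \<Longrightarrow> h (star_class G R (Gen g)) = h' (star_class G R (Gen g))"
    and x: "x \<in> carrier ?U"
  have zero: "k (star_class G R Zero) = \<zero>\<^bsub>B\<^esub>" if "k \<in> star_hom ?U B" for k
    using ring_hom_zero[of k ?U B] that U.ring_axioms B.ring_axioms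
    by (simp add: star_hom_def usa_zero)
  have "h (star_class G R t) = h' (star_class G R t)" if "t \<in> terms_over G" for t
    using that
  proof (induction t)
    case Zero then show ?case using zero[OF hom(1)] zero[OF hom(2)] by simp
  next
    case One then show ?case
      using hom ring_hom_one[of h ?U B] ring_hom_one[of h' ?U B] by (simp add: star_hom_def usa_one)
  next
    case (Add s t)
    then show ?case
      using hom ring_hom_add[of h ?U B "star_class G R s" "star_class G R t"]
        ring_hom_add[of h' ?U B "star_class G R s" "star_class G R t"]
      by (simp add: star_hom_def usa_add usa_closed)
  next
    case (Mult s t)
    then show ?case
      using hom ring_hom_mult[of h ?U B "star_class G R s" "star_class G R t"]
        ring_hom_mult[of h' ?U B "star_class G R s" "star_class G R t"]
      by (simp add: star_hom_def usa_mult usa_closed)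
  next
    case (Scale c t)
    then show ?case using hom by (simp add: star_hom_def usa_closed flip: usa_scale)
  next
    case (Star t)
    then show ?case using hom by (simp add: star_hom_def usa_closed flip: usa_star)
  qed (use gen in simp)
  then show "h x = h' x" using x by (auto simp: usa_carrier)
qed


section \<open>Quantum automorphism groups of graphs\<close>

text \<open>
  Finite simple graphs are represented as symmetric loop-free pair digraphs,
  see the locale \<^locale>\<open>pair_graph\<close>.
\<close>

definition adj_matrix :: "'v pair_pre_digraph \<Rightarrow> 'v \<Rightarrow> 'v \<Rightarrow> complex" where
  "adj_matrix X i j = (if (i, j) \<in> parcs X then 1 else 0)"

text \<open>
  The generator \<open>Gen (i, j)\<close> stands for the matrix entry \<open>u\<^sub>i\<^sub>j\<close>. Formal sums over the
  vertices need an order of summation; the relations are imposed for every enumeration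
  \<open>xs\<close> of the vertex set, and all of these are equivalent.
\<close>

inductive_set qaut_relations :: "'v pair_pre_digraph \<Rightarrow> ('v \<times> 'v) sterm rel"
  for X :: "'v pair_pre_digraph" where
  selfadjoint: "\<lbrakk>i \<in> pverts X; j \<in> pverts X\<rbrakk>
    \<Longrightarrow> (Star (Gen (i, j)), Gen (i, j)) \<in> qaut_relations X"
| idempotent: "\<lbrakk>i \<in> pverts X; j \<in> pverts X\<rbrakk>
    \<Longrightarrow> (Mult (Gen (i, j)) (Gen (i, j)), Gen (i, j)) \<in> qaut_relations X"
| row_orthogonal: "\<lbrakk>i \<in> pverts X; j \<in> pverts X; k \<in> pverts X; j \<noteq> k\<rbrakk>
    \<Longrightarrow> (Mult (Gen (i, j)) (Gen (i, k)), Zero) \<in> qaut_relations X"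
| col_orthogonal: "\<lbrakk>i \<in> pverts X; j \<in> pverts X; k \<in> pverts X; i \<noteq> k\<rbrakk>
    \<Longrightarrow> (Mult (Gen (i, j)) (Gen (k, j)), Zero) \<in> qaut_relations X"
| row_sum: "\<lbrakk>i \<in> pverts X; distinct xs; set xs = pverts X\<rbrakk>
    \<Longrightarrow> (sum_term (map (\<lambda>j. Gen (i, j)) xs), One) \<in> qaut_relations X"
| col_sum: "\<lbrakk>j \<in> pverts X; distinct xs; set xs = pverts X\<rbrakk>
    \<Longrightarrow> (sum_term (map (\<lambda>i. Gen (i, j)) xs), One) \<in> qaut_relations X"
| commutes: "\<lbrakk>i \<in> pverts X; j \<in> pverts X; distinct xs; set xs = pverts X\<rbrakk>
    \<Longrightarrow> (sum_term (map (\<lambda>k. Scale (adj_matrix X i k) (Gen (k, j))) xs),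
         sum_term (map (\<lambda>k. Scale (adj_matrix X k j) (Gen (i, k))) xs)) \<in> qaut_relations X"

definition qaut_algebra :: "'v pair_pre_digraph \<Rightarrow> ('v \<times> 'v) sterm set star_alg" where
  "qaut_algebra X = universal_star_algebra (pverts X \<times> pverts X) (qaut_relations X)"

definition no_quantum_symmetry :: "'v pair_pre_digraph \<Rightarrow> bool" where
  "no_quantum_symmetry X \<longleftrightarrow> commutative_alg (qaut_algebra X)"


text \<open>
  The relations in an arbitrary *-algebra \<open>B\<close>, with genuine sums: \<open>u\<close> is a magic unitary
  commuting with the adjacency matrix.
\<close>

definition is_qaut_matrix ::
  "'v pair_pre_digraph \<Rightarrow> ('b, 'm) star_alg_scheme \<Rightarrow> ('v \<Rightarrow> 'v \<Rightarrow> 'b) \<Rightarrow> bool" where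
  "is_qaut_matrix X B u \<longleftrightarrow> (let V = pverts X in
     (\<forall>i\<in>V. \<forall>j\<in>V. u i j \<in> carrier B \<and> invol B (u i j) = u i j \<and> u i j \<otimes>\<^bsub>B\<^esub> u i j = u i j) \<and>
     (\<forall>i\<in>V. \<forall>j\<in>V. \<forall>k\<in>V. j \<noteq> k \<longrightarrow> u i j \<otimes>\<^bsub>B\<^esub> u i k = \<zero>\<^bsub>B\<^esub>) \<and>
     (\<forall>i\<in>V. \<forall>j\<in>V. \<forall>k\<in>V. i \<noteq> k \<longrightarrow> u i j \<otimes>\<^bsub>B\<^esub> u k j = \<zero>\<^bsub>B\<^esub>) \<and>
     (\<forall>i\<in>V. (\<Oplus>\<^bsub>B\<^esub>j\<in>V. u i j) = \<one>\<^bsub>B\<^esub>) \<and>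
     (\<forall>j\<in>V. (\<Oplus>\<^bsub>B\<^esub>i\<in>V. u i j) = \<one>\<^bsub>B\<^esub>) \<and>
     (\<forall>i\<in>V. \<forall>j\<in>V. (\<Oplus>\<^bsub>B\<^esub>k\<in>V. adj_matrix X i k \<odot>\<^bsub>B\<^esub> u k j)
                = (\<Oplus>\<^bsub>B\<^esub>k\<in>V. adj_matrix X k j \<odot>\<^bsub>B\<^esub> u i k)))"

definition qaut_gen :: "'v pair_pre_digraph \<Rightarrow> 'v \<Rightarrow> 'v \<Rightarrow> ('v \<times> 'v) sterm set" where
  "qaut_gen X i j = star_class (pverts X \<times> pverts X) (qaut_relations X) (Gen (i, j))"

lemma qaut_star_algebra: "star_algebra (qaut_algebra X)"
  unfolding qaut_algebra_def by (rule usa_star_algebra)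

theorem qaut_gen_is_qaut_matrix:
  assumes "finite (pverts X)"
  shows "is_qaut_matrix X (qaut_algebra X) (qaut_gen X)"
proof -
  let ?G = "pverts X \<times> pverts X" and ?R = "qaut_relations X"
  obtain xs where xs: "set xs = pverts X" "distinct xs"
    using finite_distinct_list[OF assms] by blast
  let ?U = "universal_star_algebra ?G ?R" and ?c = "star_class ?G ?R"
  have rel: "?c s = ?c t" if "(s, t) \<in> ?R" "s \<in> terms_over ?G" "t \<in> terms_over ?G" for s t
    using that by (intro star_class_eqI star_cong.relation)
  note sums = usa_sum_term(1)[OF xs(2), where G = ?G, unfolded xs(1)]
    usa_sum_term(2)[OF xs(2), where G = ?G and R = ?R, unfolded xs(1)]
  interpret U: star_algebra ?U by (rule usa_star_algebra)
  have "(\<Oplus>\<^bsub>?U\<^esub>j\<in>pverts X. ?c (Gen (i, j))) = \<one>\<^bsub>?U\<^esub>" if "i \<in> pverts X" for i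
    using rel[OF qaut_relations.row_sum[OF that xs(2,1)]] sums[where f = "\<lambda>j. Gen (i, j)"] that
    by (simp add: usa_one)
  moreover have "(\<Oplus>\<^bsub>?U\<^esub>i\<in>pverts X. ?c (Gen (i, j))) = \<one>\<^bsub>?U\<^esub>" if "j \<in> pverts X" for j
    using rel[OF qaut_relations.col_sum[OF that xs(2,1)]] sums[where f = "\<lambda>i. Gen (i, j)"] that
    by (simp add: usa_one)
  moreover have "(\<Oplus>\<^bsub>?U\<^esub>k\<in>pverts X. adj_matrix X i k \<odot>\<^bsub>?U\<^esub> ?c (Gen (k, j)))
      = (\<Oplus>\<^bsub>?U\<^esub>k\<in>pverts X. adj_matrix X k j \<odot>\<^bsub>?U\<^esub> ?c (Gen (i, k)))"
    if ij: "i \<in> pverts X" "j \<in> pverts X" for i j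
  proof -
    let ?l = "\<lambda>k. Scale (adj_matrix X i k) (Gen (k, j))"
    let ?r = "\<lambda>k. Scale (adj_matrix X k j) (Gen (i, k))"
    have "(\<Oplus>\<^bsub>?U\<^esub>k\<in>pverts X. ?c (?l k)) = (\<Oplus>\<^bsub>?U\<^esub>k\<in>pverts X. ?c (?r k))"
      using rel[OF qaut_relations.commutes[OF ij xs(2,1)]] sums[where f = ?l] sums[where f = ?r] ij by simp
    moreover have "(\<Oplus>\<^bsub>?U\<^esub>k\<in>pverts X. adj_matrix X i k \<odot>\<^bsub>?U\<^esub> ?c (Gen (k, j)))
        = (\<Oplus>\<^bsub>?U\<^esub>k\<in>pverts X. ?c (?l k))"
      using ij by (intro U.finsum_cong') (auto simp: usa_scale usa_closed)
    moreover have "(\<Oplus>\<^bsub>?U\<^esub>k\<in>pverts X. adj_matrix X k j \<odot>\<^bsub>?U\<^esub> ?c (Gen (i, k)))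
        = (\<Oplus>\<^bsub>?U\<^esub>k\<in>pverts X. ?c (?r k))"
      using ij by (intro U.finsum_cong') (auto simp: usa_scale usa_closed)
    ultimately show ?thesis by simp
  qed
  ultimately show ?thesis
    by (simp add: is_qaut_matrix_def qaut_algebra_def qaut_gen_def Let_def usa_ops usa_closed
        rel[OF qaut_relations.selfadjoint] rel[OF qaut_relations.idempotent]
        rel[OF qaut_relations.row_orthogonal] rel[OF qaut_relations.col_orthogonal])
qed

theorem qaut_algebra_universal:
  fixes B :: "('b, 'm) star_alg_scheme"
  assumes "finite (pverts X)" and B: "star_algebra B" and u: "is_qaut_matrix X B u"
  shows "\<exists>h \<in> star_hom (qaut_algebra X) B. \<forall>i\<in>pverts X. \<forall>j\<in>pverts X. h (qaut_gen X i j) = u i j"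
proof -
  interpret B: star_algebra B by (rule B)
  let ?V = "pverts X"
  let ?f = "\<lambda>(i, j). u i j"
  have cl: "u i j \<in> carrier B" if "i \<in> ?V" "j \<in> ?V" for i j
    using u that by (auto simp: is_qaut_matrix_def Let_def)
  have f: "?f \<in> ?V \<times> ?V \<rightarrow> carrier B" by (auto simp: cl)
  have "eval_term B ?f s = eval_term B ?f t" if "(s, t) \<in> qaut_relations X" for s t
    using that
  proof cases
    case (row_sum i xs)
    then have "eval_term B ?f s = (\<Oplus>\<^bsub>B\<^esub>j\<in>?V. eval_term B ?f (Gen (i, j)))"
      using B.eval_sum_term[of xs ?f "\<lambda>j. Gen (i, j)"] cl by simp
    then show ?thesis using u row_sum by (simp add: is_qaut_matrix_def Let_def)
  next
    case (col_sum j xs)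
    then have "eval_term B ?f s = (\<Oplus>\<^bsub>B\<^esub>i\<in>?V. eval_term B ?f (Gen (i, j)))"
      using B.eval_sum_term[of xs ?f "\<lambda>i. Gen (i, j)"] cl by simp
    then show ?thesis using u col_sum by (simp add: is_qaut_matrix_def Let_def)
  next
    case (commutes i j xs)
    let ?l = "\<lambda>k. Scale (adj_matrix X i k) (Gen (k, j))"
    let ?r = "\<lambda>k. Scale (adj_matrix X k j) (Gen (i, k))"
    have "eval_term B ?f s = (\<Oplus>\<^bsub>B\<^esub>k\<in>?V. eval_term B ?f (?l k))"
      using commutes B.eval_sum_term[of xs ?f ?l] cl by (simp add: B.scale_closed)
    moreover have "eval_term B ?f t = (\<Oplus>\<^bsub>B\<^esub>k\<in>?V. eval_term B ?f (?r k))"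
      using commutes B.eval_sum_term[of xs ?f ?r] cl by (simp add: B.scale_closed)
    ultimately show ?thesis using u commutes by (simp add: is_qaut_matrix_def Let_def)
  qed (use u in \<open>auto simp: is_qaut_matrix_def Let_def\<close>)
  from universal_property(1)[OF B f this] show ?thesis
    by (fastforce simp: qaut_algebra_def qaut_gen_def)
qed


section \<open>The graph \<open>O\<^sup>-(6,2)\<close> and the Schlaefli graph\<close>

definition Q_e :: "bit \<Rightarrow> bit \<Rightarrow> bit" where
  "Q_e a b = a\<^sup>2 + a * b + b\<^sup>2"

definition Q_form :: "bit ^ 6 \<Rightarrow> bit" where
  "Q_form v = v $ 0 * v $ 1 + v $ 2 * v $ 3 + Q_e (v $ 4) (v $ 5)"

definition O_minus_6_2 :: "(bit ^ 6) set pair_pre_digraph" where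
  "O_minus_6_2 =
    \<lparr> pverts = {vec.span {v} | v. v \<noteq> 0 \<and> Q_form v = 0},
      parcs = {(vec.span {v}, vec.span {w}) | v w.
        v \<noteq> 0 \<and> Q_form v = 0 \<and> w \<noteq> 0 \<and> Q_form w = 0 \<and>
        vec.span {v} \<noteq> vec.span {w} \<and> Q_form (v + w) = 0} \<rparr>"

definition graph_complement :: "'v pair_pre_digraph \<Rightarrow> 'v pair_pre_digraph" where
  "graph_complement X =
    \<lparr> pverts = pverts X,
      parcs = {(v, w). v \<in> pverts X \<and> w \<in> pverts X \<and> v \<noteq> w \<and> (v, w) \<notin> parcs X} \<rparr>"

definition schlafli_graph :: "(bit ^ 6) set pair_pre_digraph" where
  "schlafli_graph = graph_complement O_minus_6_2"

lemma UNIV_bit: "(UNIV :: bit set) = {0, 1}"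
  by (auto intro: bit.exhaust)

instance bit :: finite
  by standard (simp add: UNIV_bit)

lemma span_bit: "vec.span {v} = {0, v}" for v :: "bit ^ 6"
proof -
  have "vec.span {v} = range (\<lambda>c. c *s v)" by (rule vec.span_singleton)
  also have "\<dots> = {0, v}" by (simp add: UNIV_bit)
  finally show ?thesis .
qed

lemma pair_graph_O_minus_6_2: "pair_graph O_minus_6_2"
proof
  show "finite (pverts O_minus_6_2)" "finite (parcs O_minus_6_2)" by (rule finite)+
  have "sym (parcs O_minus_6_2)"
  proof (rule symI)
    fix p q assume "(p, q) \<in> parcs O_minus_6_2"
    then obtain v w where "p = vec.span {v}" "q = vec.span {w}" "p \<noteq> q"
      "v \<noteq> 0" "Q_form v = 0" "w \<noteq> 0" "Q_form w = 0" "Q_form (w + v) = 0"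
      unfolding O_minus_6_2_def by (auto simp: add.commute)
    then show "(q, p) \<in> parcs O_minus_6_2"
      unfolding O_minus_6_2_def by auto
  qed
  then show "symmetric (with_proj O_minus_6_2)" by (simp add: symmetric_def)
  fix e assume "e \<in> parcs O_minus_6_2"
  then obtain v w where "e = (vec.span {v}, vec.span {w})" "vec.span {v} \<noteq> vec.span {w}"
      "v \<noteq> 0" "Q_form v = 0" "w \<noteq> 0" "Q_form w = 0"
    unfolding O_minus_6_2_def by auto
  then show "fst e \<in> pverts O_minus_6_2" "snd e \<in> pverts O_minus_6_2" "fst e \<noteq> snd e"
    unfolding O_minus_6_2_def by auto
qed

lemma pair_graph_complement:
  assumes "pair_graph X"
  shows "pair_graph (graph_complement X)"
proof -
  interpret X: pair_graph X by fact
  show ?thesis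
  proof
    show "finite (parcs (graph_complement X))"
      by (rule finite_subset[of _ "pverts X \<times> pverts X"])
        (auto simp: graph_complement_def X.pair_finite_verts)
    show "symmetric (with_proj (graph_complement X))"
      using X.pair_sym_arcs by (auto simp: symmetric_def graph_complement_def sym_def)
  qed (auto simp: graph_complement_def X.pair_finite_verts)
qed

lemma pair_graph_schlafli: "pair_graph schlafli_graph"
  unfolding schlafli_graph_def by (intro pair_graph_complement pair_graph_O_minus_6_2)

end

theory Submission
  imports Defs
begin

text \<open>
  Let \<open>u\<close> be a magic unitary commuting with the adjacency matrix. Entries \<open>u\<^sub>i\<^sub>j\<close>, \<open>u\<^sub>k\<^sub>l\<close> multiply to zero
  unless \<open>i \<sim> k\<close> and \<open>j \<sim> l\<close> agree. If every edge lies in a unique triangle and \<open>ikt\<close>, \<open>jlm\<close> are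
  triangles, comparing the \<open>(t, l)\<close> entries of \<open>Au = uA\<close> after multiplication by \<open>u\<^sub>i\<^sub>j\<close> gives
  \<open>u\<^sub>i\<^sub>j u\<^sub>k\<^sub>l = u\<^sub>i\<^sub>j u\<^sub>t\<^sub>m\<close>; three such exchanges turn \<open>u\<^sub>i\<^sub>j u\<^sub>k\<^sub>l\<close> into \<open>u\<^sub>k\<^sub>l u\<^sub>i\<^sub>j\<close>. For non-adjacent pairs
  and \<open>p \<noteq> j\<close> not adjacent to \<open>l\<close>, take a common neighbour \<open>s\<close> of \<open>j\<close> and \<open>l\<close> that is not adjacent to \<open>p\<close> and insert
  \<open>\<Sum>\<^sub>t u\<^sub>t\<^sub>s = 1\<close> between \<open>u\<^sub>i\<^sub>j\<close> and \<open>u\<^sub>k\<^sub>l\<close>: the surviving \<open>u\<^sub>t\<^sub>s\<close> commute past \<open>u\<^sub>k\<^sub>l\<close> and annihilate \<open>u\<^sub>i\<^sub>p\<close>.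
  Hence \<open>u\<^sub>i\<^sub>j u\<^sub>k\<^sub>l = u\<^sub>i\<^sub>j u\<^sub>k\<^sub>l u\<^sub>i\<^sub>j\<close> is self-adjoint. A graph and its complement impose the same
  relations on \<open>u\<close>.
\<close>


section \<open>Magic unitaries commuting with an adjacency matrix\<close>

context star_algebra
begin

lemma scale_zero: "x \<in> carrier A \<Longrightarrow> 0 \<odot> x = \<zero>"
  using scale_add_left[of x 0 0] scale_closed[of x 0] by (simp add: local.add.l_cancel_one')

lemma adj_matrix_scale:
  "x \<in> carrier A \<Longrightarrow> adj_matrix X i k \<odot> x = (if (i, k) \<in> parcs X then x else \<zero>)"
  by (simp add: adj_matrix_def scale_zero scale_one)

text \<open>Collapses sums in which all products but one vanish; closure is asked only at
  \<open>a\<close>, since the other terms are \<open>\<zero>\<close>.\<close>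

lemma finsum_only:
  assumes "finite S" "a \<in> S" "f a \<in> carrier A" "\<And>k. k \<in> S \<Longrightarrow> k \<noteq> a \<Longrightarrow> f k = \<zero>"
  shows "(\<Oplus>k\<in>S. f k) = f a"
proof -
  have "f k \<in> carrier A" if "k \<in> S" for k
    using assms that by (cases "k = a") auto
  then have "(\<Oplus>k\<in>S. f k) = (\<Oplus>k\<in>S. if a = k then f k else \<zero>)"
    using assms by (intro add.finprod_cong') auto
  also have "\<dots> = f a"
    using assms \<open>\<And>k. k \<in> S \<Longrightarrow> f k \<in> carrier A\<close> by (intro add.finprod_singleton) auto
  finally show ?thesis .
qed

end

locale quantum_automorphism =
  star_algebra B + X: pair_graph X for B :: "('b, 'm) star_alg_scheme" (structure)
    and X :: "'v pair_pre_digraph" +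
  fixes u :: "'v \<Rightarrow> 'v \<Rightarrow> 'b"
  assumes qaut_matrix: "is_qaut_matrix X B u"
begin

abbreviation "V \<equiv> pverts X"
abbreviation "E \<equiv> parcs X"

lemma u_closed [simp]: "i \<in> V \<Longrightarrow> j \<in> V \<Longrightarrow> u i j \<in> carrier B"
  and u_star [simp]: "i \<in> V \<Longrightarrow> j \<in> V \<Longrightarrow> invol B (u i j) = u i j"
  and u_idem [simp]: "i \<in> V \<Longrightarrow> j \<in> V \<Longrightarrow> u i j \<otimes> u i j = u i j"
  and row_orth: "i \<in> V \<Longrightarrow> j \<in> V \<Longrightarrow> k \<in> V \<Longrightarrow> j \<noteq> k \<Longrightarrow> u i j \<otimes> u i k = \<zero>"
  and col_orth: "i \<in> V \<Longrightarrow> j \<in> V \<Longrightarrow> k \<in> V \<Longrightarrow> i \<noteq> k \<Longrightarrow> u i j \<otimes> u k j = \<zero>"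
  and row_sum: "i \<in> V \<Longrightarrow> (\<Oplus>j\<in>V. u i j) = \<one>"
  and col_sum: "j \<in> V \<Longrightarrow> (\<Oplus>i\<in>V. u i j) = \<one>"
  using qaut_matrix unfolding is_qaut_matrix_def Let_def by blast+

lemma neighbour_sum:
  assumes "i \<in> V" "j \<in> V"
  shows "(\<Oplus>k\<in>V. if (i, k) \<in> E then u k j else \<zero>) = (\<Oplus>k\<in>V. if (k, j) \<in> E then u i k else \<zero>)"
proof -
  have "(\<Oplus>k\<in>V. adj_matrix X i k \<odot> u k j) = (\<Oplus>k\<in>V. adj_matrix X k j \<odot> u i k)"
    using qaut_matrix assms unfolding is_qaut_matrix_def Let_def by blast
  moreover have "(\<Oplus>k\<in>V. adj_matrix X i k \<odot> u k j) = (\<Oplus>k\<in>V. if (i, k) \<in> E then u k j else \<zero>)"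
    using assms by (intro add.finprod_cong') (auto simp: adj_matrix_scale)
  moreover have "(\<Oplus>k\<in>V. adj_matrix X k j \<odot> u i k) = (\<Oplus>k\<in>V. if (k, j) \<in> E then u i k else \<zero>)"
    using assms by (intro add.finprod_cong') (auto simp: adj_matrix_scale)
  ultimately show ?thesis by simp
qed

lemma adj_sym: "(i, k) \<in> E \<Longrightarrow> (k, i) \<in> E"
  using X.pair_sym_arcs by (auto simp: symmetric_def dest: symD)

lemma adj_in_verts: "(i, k) \<in> E \<Longrightarrow> i \<in> V" "(i, k) \<in> E \<Longrightarrow> k \<in> V"
  by (blast dest: X.in_arcsD1 X.in_arcsD2)+

text \<open>This is the \<open>(t, l)\<close> entry of \<open>Au = uA\<close>, multiplied by
  \<open>u i j\<close> from the left. Suitable \<open>t\<close> and \<open>l\<close> leave one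
  summand on each side.\<close>

lemma mult_neighbour_sum:
  assumes "i \<in> V" "j \<in> V" "t \<in> V" "l \<in> V"
  shows "(\<Oplus>k\<in>V. if (t, k) \<in> E then u i j \<otimes> u k l else \<zero>)
       = (\<Oplus>k\<in>V. if (k, l) \<in> E then u i j \<otimes> u t k else \<zero>)"
proof -
  have "u i j \<otimes> (\<Oplus>k\<in>V. if (t, k) \<in> E then u k l else \<zero>)
      = (\<Oplus>k\<in>V. if (t, k) \<in> E then u i j \<otimes> u k l else \<zero>)"
    using assms by (subst finsum_rdistr) (auto intro!: add.finprod_cong')
  moreover have "u i j \<otimes> (\<Oplus>k\<in>V. if (k, l) \<in> E then u t k else \<zero>)
      = (\<Oplus>k\<in>V. if (k, l) \<in> E then u i j \<otimes> u t k else \<zero>)"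
    using assms by (subst finsum_rdistr) (auto intro!: add.finprod_cong')
  ultimately show ?thesis using neighbour_sum[of t l] assms by simp
qed

text \<open>Multiply the \<open>(i, l)\<close> entry of \<open>Au = uA\<close> by
  \<open>u i j\<close> on the left and \<open>u k l\<close> on the right. Column orthogonality keeps
  only \<open>k\<close> on one side, row orthogonality only \<open>j\<close> on the other, so the
  product survives there iff \<open>(i, k) \<in> E\<close> and here iff
  \<open>(j, l) \<in> E\<close>.\<close>

lemma mult_eq_zero:
  assumes V: "i \<in> V" "j \<in> V" "k \<in> V" "l \<in> V" and ne: "((i, k) \<in> E) \<noteq> ((j, l) \<in> E)"
  shows "u i j \<otimes> u k l = \<zero>"
proof -
  let ?y = "u i j \<otimes> u k l"
  have "(\<Oplus>k'\<in>V. if (i, k') \<in> E then u i j \<otimes> u k' l else \<zero>) \<otimes> u k l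
      = (\<Oplus>k'\<in>V. (if (i, k') \<in> E then u i j \<otimes> u k' l else \<zero>) \<otimes> u k l)"
    using V by (intro finsum_ldistr) auto
  also have "\<dots> = (if (i, k) \<in> E then u i j \<otimes> u k l else \<zero>) \<otimes> u k l"
    using V by (intro finsum_only) (auto simp: m_assoc col_orth)
  also have "\<dots> = (if (i, k) \<in> E then ?y else \<zero>)"
    using V by (simp add: m_assoc)
  finally have "(\<Oplus>k'\<in>V. if (i, k') \<in> E then u i j \<otimes> u k' l else \<zero>) \<otimes> u k l
      = (if (i, k) \<in> E then ?y else \<zero>)" .
  moreover have "(\<Oplus>k'\<in>V. if (k', l) \<in> E then u i j \<otimes> u i k' else \<zero>)
      = (if (j, l) \<in> E then u i j \<otimes> u i j else \<zero>)"
    using V by (intro finsum_only) (auto simp: row_orth)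
  ultimately have "(if (i, k) \<in> E then ?y else \<zero>) = (if (j, l) \<in> E then ?y else \<zero>)"
    using mult_neighbour_sum[of i j i l] V by (simp split: if_splits)
  then show ?thesis using ne by (auto split: if_splits)
qed

text \<open>The triple product is its own adjoint, whereas the adjoint of
  \<open>u i j \<otimes> u k l\<close> is the product in reverse order.\<close>

lemma commute_if_absorb:
  assumes "i \<in> V" "j \<in> V" "k \<in> V" "l \<in> V" "u i j \<otimes> u k l = u i j \<otimes> u k l \<otimes> u i j"
  shows "u i j \<otimes> u k l = u k l \<otimes> u i j"
proof -
  have "u k l \<otimes> u i j = invol B (u i j \<otimes> u k l)" using assms by (simp add: invol_mult)
  also have "\<dots> = invol B (u i j \<otimes> u k l \<otimes> u i j)" using assms(5) by simp
  also have "\<dots> = u i j \<otimes> u k l \<otimes> u i j" using assms(1-4) by (simp add: invol_mult m_assoc)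
  finally show ?thesis using assms(5) by simp
qed

lemma commute_same_row:
  assumes "i \<in> V" "j \<in> V" "l \<in> V" shows "u i j \<otimes> u i l = u i l \<otimes> u i j"
  using assms row_orth[of i j l] row_orth[of i l j] by (cases "j = l") auto

lemma commute_same_col:
  assumes "i \<in> V" "k \<in> V" "j \<in> V" shows "u i j \<otimes> u k j = u k j \<otimes> u i j"
  using assms col_orth[of i j k] col_orth[of k j i] by (cases "i = k") auto

lemma commute_mismatch:
  assumes "i \<in> V" "j \<in> V" "k \<in> V" "l \<in> V" "((i, k) \<in> E) \<noteq> ((j, l) \<in> E)"
  shows "u i j \<otimes> u k l = u k l \<otimes> u i j"
  using mult_eq_zero[OF assms] mult_eq_zero[OF assms(3,4,1,2)] assms(5) adj_sym by metis

end

section \<open>Graphs in which every edge lies in exactly one triangle\<close>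

locale unique_triangle_quantum_automorphism = quantum_automorphism +
  assumes unique_triangle: "\<And>i k. (i, k) \<in> E \<Longrightarrow> \<exists>!t. (i, t) \<in> E \<and> (k, t) \<in> E"
begin

lemma common_neighbour_unique:
  "(i, t) \<in> E \<Longrightarrow> (i, k) \<in> E \<Longrightarrow> (t, k) \<in> E \<Longrightarrow> (i, k') \<in> E \<Longrightarrow> (t, k') \<in> E \<Longrightarrow> k' = k"
  using unique_triangle by blast

lemma triangle_right:
  assumes t: "(i, k) \<in> E" "(i, t) \<in> E" "(k, t) \<in> E" and m: "(j, l) \<in> E" "(j, m) \<in> E" "(l, m) \<in> E"
  shows "u i j \<otimes> u k l = u i j \<otimes> u t m"
proof -
  note V = t[THEN adj_in_verts(1)] t[THEN adj_in_verts(2)] m[THEN adj_in_verts(1)] m[THEN adj_in_verts(2)]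
  note t' = t[THEN adj_sym] and m' = m[THEN adj_sym]
  have "(\<Oplus>k'\<in>V. if (t, k') \<in> E then u i j \<otimes> u k' l else \<zero>)
      = (if (t, k) \<in> E then u i j \<otimes> u k l else \<zero>)"
  proof (rule finsum_only)
    fix k' assume k': "k' \<in> V" "k' \<noteq> k"
    \<comment> \<open>Since \<open>j\<close> is adjacent to \<open>l\<close>, a nonzero term needs
      \<open>k'\<close> adjacent to \<open>i\<close>; then \<open>k'\<close> completes the triangle
      on the edge \<open>(i, t)\<close>, so it is \<open>k\<close>.\<close>
    have "u i j \<otimes> u k' l = \<zero>" if "(t, k') \<in> E"
      using common_neighbour_unique[OF t(2,1) t'(3) _ that] k' V m(1)
      by (intro mult_eq_zero) auto
    then show "(if (t, k') \<in> E then u i j \<otimes> u k' l else \<zero>) = \<zero>" by simp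
  qed (use V in auto)
  moreover have "(\<Oplus>k'\<in>V. if (k', l) \<in> E then u i j \<otimes> u t k' else \<zero>)
      = (if (m, l) \<in> E then u i j \<otimes> u t m else \<zero>)"
  proof (rule finsum_only)
    fix k' assume k': "k' \<in> V" "k' \<noteq> m"
    \<comment> \<open>Likewise \<open>i\<close> is adjacent to \<open>t\<close>, so
      \<open>k'\<close> would have to complete the triangle on \<open>(j, l)\<close>, whose third
      vertex is \<open>m\<close>.\<close>
    have "u i j \<otimes> u t k' = \<zero>" if "(k', l) \<in> E"
      using common_neighbour_unique[OF m(1,2,3) _ adj_sym[OF that]] k' V t(2)
      by (intro mult_eq_zero) auto
    then show "(if (k', l) \<in> E then u i j \<otimes> u t k' else \<zero>) = \<zero>" by simp
  qed (use V in auto)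
  ultimately show ?thesis
    using mult_neighbour_sum[of i j t l] V t'(3) m'(3) by simp
qed

lemma triangle_left:
  assumes t: "(i, k) \<in> E" "(i, t) \<in> E" "(k, t) \<in> E" and m: "(j, l) \<in> E" "(j, m) \<in> E" "(l, m) \<in> E"
  shows "u k l \<otimes> u i j = u t m \<otimes> u i j"
proof -
  note V = t[THEN adj_in_verts(1)] t[THEN adj_in_verts(2)] m[THEN adj_in_verts(1)] m[THEN adj_in_verts(2)]
  have "invol B (u i j \<otimes> u k l) = invol B (u i j \<otimes> u t m)"
    using triangle_right[OF assms] by simp
  then show ?thesis using V by (simp add: invol_mult)
qed

text \<open>With third vertices \<open>t\<close> and \<open>m\<close>, each exchange fixes one
  factor and moves the other: the right one from \<open>(k, l)\<close> to \<open>(t, m)\<close>, the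
  left one from \<open>(i, j)\<close> to \<open>(k, l)\<close>, and the right one from
  \<open>(t, m)\<close> to \<open>(i, j)\<close>.\<close>

lemma commute_adjacent:
  assumes e: "(i, k) \<in> E" "(j, l) \<in> E"
  shows "u i j \<otimes> u k l = u k l \<otimes> u i j"
proof -
  obtain t m where t: "(i, t) \<in> E" "(k, t) \<in> E" and m: "(j, m) \<in> E" "(l, m) \<in> E"
    using unique_triangle e by meson
  note e' = e[THEN adj_sym] and t' = t[THEN adj_sym] and m' = m[THEN adj_sym]
  have "u i j \<otimes> u k l = u i j \<otimes> u t m"
    by (rule triangle_right[OF e(1) t e(2) m])
  also have "\<dots> = u k l \<otimes> u t m"
    by (rule triangle_left[OF t'(1,2) e(1) m'(1,2) e(2)])
  also have "\<dots> = u k l \<otimes> u i j"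
    by (rule triangle_right[OF t(2) e'(1) t'(1) m(2) e'(2) m'(1)])
  finally show ?thesis .
qed

text \<open>Inserting the column sum over \<open>u t s\<close> after \<open>u i j\<close> gives
  terms that vanish separately. Unless \<open>t\<close> is adjacent to both \<open>i\<close> and
  \<open>k\<close>, a mismatch with \<open>u i j\<close> or \<open>u k l\<close> kills the term;
  otherwise \<open>u t s\<close> moves past \<open>u k l\<close> and meets
  \<open>u i p\<close>.\<close>

lemma mult3_eq_zero:
  assumes V: "i \<in> V" "j \<in> V" "k \<in> V" "l \<in> V" "p \<in> V"
    and s: "(s, j) \<in> E" "(s, l) \<in> E" "(s, p) \<notin> E"
  shows "u i j \<otimes> u k l \<otimes> u i p = \<zero>"
proof -
  have sV: "s \<in> V" using s adj_in_verts by blast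
  have "u i j \<otimes> u k l \<otimes> u i p = u i j \<otimes> ((\<Oplus>t\<in>V. u t s) \<otimes> (u k l \<otimes> u i p))"
    using V sV by (simp add: col_sum m_assoc)
  also have "\<dots> = (\<Oplus>t\<in>V. u i j \<otimes> (u t s \<otimes> (u k l \<otimes> u i p)))"
    using V sV by (simp add: finsum_ldistr finsum_rdistr)
  also have "\<dots> = (\<Oplus>t\<in>V. \<zero>)"
  proof (rule add.finprod_cong')
    fix t assume t: "t \<in> V"
    show "u i j \<otimes> (u t s \<otimes> (u k l \<otimes> u i p)) = \<zero>"
    proof (cases "(t, i) \<in> E \<and> (t, k) \<in> E")
      case True
      then have "u t s \<otimes> (u k l \<otimes> u i p) = (u k l \<otimes> u t s) \<otimes> u i p"
        using commute_adjacent[of t k s l] s V sV t by (simp flip: m_assoc)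
      also have "\<dots> = u k l \<otimes> (u t s \<otimes> u i p)"
        using V sV t by (simp add: m_assoc)
      \<comment> \<open>The edge \<open>(t, i)\<close> faces the non-edge
        \<open>(s, p)\<close>.\<close>
      also have "u t s \<otimes> u i p = \<zero>"
        using True s V sV t by (intro mult_eq_zero) auto
      finally show ?thesis using V by simp
    next
      case False
      then consider "(i, t) \<notin> E" | "(t, k) \<notin> E" using adj_sym by blast
      then show ?thesis
      proof cases
        case 1
        then have "(u i j \<otimes> u t s) \<otimes> (u k l \<otimes> u i p) = \<zero>"
          using mult_eq_zero[of i j t s] adj_sym[OF s(1)] V sV t by simp
        then show ?thesis using V sV t by (simp add: m_assoc)
      next
        case 2
        then have "u i j \<otimes> ((u t s \<otimes> u k l) \<otimes> u i p) = \<zero>"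
          using mult_eq_zero[of t s k l] s(2) V sV t by simp
        then show ?thesis using V sV t by (simp add: m_assoc)
      qed
    qed
  qed (use V in auto)
  finally show ?thesis by simp
qed

text \<open>Multiplying by the row sum over \<open>u i p\<close> leaves only \<open>p = j\<close>,
  which is the absorption that \<open>commute_if_absorb\<close> asks for. The assumption
  \<open>separated\<close> supplies the vertex \<open>s\<close> of
  \<open>mult3_eq_zero\<close>.\<close>

lemma commute_nonadjacent:
  assumes separated: "\<And>j l p. \<lbrakk>j \<in> V; l \<in> V; p \<in> V; j \<noteq> l; p \<noteq> l; p \<noteq> j; (j, l) \<notin> E; (p, l) \<notin> E\<rbrakk>
      \<Longrightarrow> \<exists>s. (s, j) \<in> E \<and> (s, l) \<in> E \<and> (s, p) \<notin> E"
    and V: "i \<in> V" "j \<in> V" "k \<in> V" "l \<in> V" and ne: "i \<noteq> k" "j \<noteq> l" "(i, k) \<notin> E" "(j, l) \<notin> E"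
  shows "u i j \<otimes> u k l = u k l \<otimes> u i j"
proof (rule commute_if_absorb)
  have "u i j \<otimes> u k l = u i j \<otimes> u k l \<otimes> (\<Oplus>p\<in>V. u i p)"
    using V by (simp add: row_sum)
  also have "\<dots> = (\<Oplus>p\<in>V. u i j \<otimes> u k l \<otimes> u i p)"
    using V by (intro finsum_rdistr) auto
  also have "\<dots> = u i j \<otimes> u k l \<otimes> u i j"
  proof (rule finsum_only)
    fix p assume p: "p \<in> V" "p \<noteq> j"
    show "u i j \<otimes> u k l \<otimes> u i p = \<zero>"
    \<comment> \<open>For these \<open>p\<close> the last two factors already annihilate each other:
      by column orthogonality if \<open>p = l\<close>, by the mismatch with the non-edge
      \<open>(i, k)\<close> otherwise.\<close>
    proof (cases "p = l \<or> (p, l) \<in> E")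
      case True
      then have "u k l \<otimes> u i p = \<zero>"
        using col_orth[of k l i] mult_eq_zero[of k l i p] V p ne adj_sym by metis
      then show ?thesis using V p by (simp add: m_assoc)
    next
      case False
      then show ?thesis using separated[of j l p] mult3_eq_zero V p ne by blast
    qed
  qed (use V in auto)
  finally show "u i j \<otimes> u k l = u i j \<otimes> u k l \<otimes> u i j" .
qed (use V in auto)

lemma commute:
  assumes separated: "\<And>j l p. \<lbrakk>j \<in> V; l \<in> V; p \<in> V; j \<noteq> l; p \<noteq> l; p \<noteq> j; (j, l) \<notin> E; (p, l) \<notin> E\<rbrakk>
      \<Longrightarrow> \<exists>s. (s, j) \<in> E \<and> (s, l) \<in> E \<and> (s, p) \<notin> E"
    and V: "i \<in> V" "j \<in> V" "k \<in> V" "l \<in> V"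
  shows "u i j \<otimes> u k l = u k l \<otimes> u i j"
proof -
  consider "i = k" | "j = l" | "((i, k) \<in> E) \<noteq> ((j, l) \<in> E)" | "(i, k) \<in> E" "(j, l) \<in> E"
    | "i \<noteq> k" "j \<noteq> l" "(i, k) \<notin> E" "(j, l) \<notin> E" by blast
  then show ?thesis
  proof cases
    case 1
    then show ?thesis using V commute_same_row by simp
  next
    case 2
    then show ?thesis using V commute_same_col by simp
  next
    case 3
    then show ?thesis by (rule commute_mismatch[OF V])
  next
    case 4
    then show ?thesis by (rule commute_adjacent)
  next
    case 5
    with V show ?thesis by (intro commute_nonadjacent separated)
  qed
qed

end

section \<open>Complements and commutativity of the universal algebra\<close>

text \<open>The two adjacency matrices and the identity add up to the all-ones matrix. That matrix
  commutes with \<open>u\<close> because all row and column sums are \<open>\<one>\<close>, so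
  commuting with one adjacency matrix forces commuting with the other.\<close>

lemma is_qaut_matrix_complement:
  assumes B: "star_algebra B" and X: "pair_graph X" and u: "is_qaut_matrix (graph_complement X) B u"
  shows "is_qaut_matrix X B u"
proof -
  interpret star_algebra B by (rule B)
  interpret X: pair_graph X by (rule X)
  let ?Y = "graph_complement X" and ?V = "pverts X"
  have V: "pverts ?Y = ?V" by (simp add: graph_complement_def)
  have loop: "(i, i) \<notin> parcs X" for i using X.pair_no_loops by fastforce
  interpret q: quantum_automorphism B ?Y u
    by (intro quantum_automorphism.intro quantum_automorphism_axioms.intro B X pair_graph_complement u)
  note q = q.u_closed[unfolded V] q.row_sum[unfolded V] q.col_sum[unfolded V]
    q.neighbour_sum[unfolded V]
  note adj_matrix_scale [where X = X, simp]
  have "(\<Oplus>\<^bsub>B\<^esub>k\<in>?V. adj_matrix X i k \<odot>\<^bsub>B\<^esub> u k j) = (\<Oplus>\<^bsub>B\<^esub>k\<in>?V. adj_matrix X k j \<odot>\<^bsub>B\<^esub> u i k)"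
    if ij: "i \<in> ?V" "j \<in> ?V" for i j
  proof -
    let ?S = "\<lambda>f. finsum B f ?V"
    let ?a = "\<lambda>k. if (i, k) \<in> parcs X then u k j else \<zero>\<^bsub>B\<^esub>"
    let ?a' = "\<lambda>k. if (i, k) \<in> parcs ?Y then u k j else \<zero>\<^bsub>B\<^esub>"
    let ?d = "\<lambda>k. if i = k then u k j else \<zero>\<^bsub>B\<^esub>"
    let ?b = "\<lambda>k. if (k, j) \<in> parcs X then u i k else \<zero>\<^bsub>B\<^esub>"
    let ?b' = "\<lambda>k. if (k, j) \<in> parcs ?Y then u i k else \<zero>\<^bsub>B\<^esub>"
    let ?e = "\<lambda>k. if j = k then u i k else \<zero>\<^bsub>B\<^esub>"
    have d: "?S ?d = u i j" "?S ?e = u i j"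
      using ij q(1) by (auto intro!: add.finprod_singleton)
    have "?S ?a \<oplus>\<^bsub>B\<^esub> (?S ?a' \<oplus>\<^bsub>B\<^esub> ?S ?d) = ?S (\<lambda>k. ?a k \<oplus>\<^bsub>B\<^esub> (?a' k \<oplus>\<^bsub>B\<^esub> ?d k))"
      using ij q(1) by (simp add: finsum_addf Pi_def)
    also have "\<dots> = ?S (\<lambda>k. u k j)"
      using ij q(1) loop by (intro add.finprod_cong') (auto simp: graph_complement_def)
    \<comment> \<open>Both sides are \<open>\<one>\<close>; this is the \<open>(i, j)\<close> entry
      of the identity for the all-ones matrix.\<close>
    also have "\<dots> = ?S (\<lambda>k. u i k)" using ij q(2,3) by simp
    also have "\<dots> = ?S (\<lambda>k. ?b k \<oplus>\<^bsub>B\<^esub> (?b' k \<oplus>\<^bsub>B\<^esub> ?e k))"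
      using ij q(1) loop by (intro add.finprod_cong') (auto simp: graph_complement_def)
    also have "\<dots> = ?S ?b \<oplus>\<^bsub>B\<^esub> (?S ?b' \<oplus>\<^bsub>B\<^esub> ?S ?e)"
      using ij q(1) by (simp add: finsum_addf Pi_def)
    finally have "?S ?a \<oplus>\<^bsub>B\<^esub> (?S ?a' \<oplus>\<^bsub>B\<^esub> u i j) = ?S ?b \<oplus>\<^bsub>B\<^esub> (?S ?a' \<oplus>\<^bsub>B\<^esub> u i j)"
      using q(4)[OF ij] d by simp
    then have "?S ?a = ?S ?b"
      using ij q(1) by (subst (asm) add.right_cancel) (auto intro!: finsum_closed)
    moreover have "(\<Oplus>\<^bsub>B\<^esub>k\<in>?V. adj_matrix X i k \<odot>\<^bsub>B\<^esub> u k j) = ?S ?a"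
      "(\<Oplus>\<^bsub>B\<^esub>k\<in>?V. adj_matrix X k j \<odot>\<^bsub>B\<^esub> u i k) = ?S ?b"
      using ij q(1) by (auto intro!: add.finprod_cong')
    ultimately show ?thesis by simp
  qed
  then show ?thesis
    using u unfolding is_qaut_matrix_def Let_def V by blast
qed

section \<open>From commuting generators to a commutative algebra\<close>

context star_algebra
begin

text \<open>Two inductions: first a term against a single generator, then a term against a term.
  Self-adjoint generators are needed so that \<open>Star\<close> stays within the elements commuting
  with a generator.\<close>

lemma eval_terms_commute:
  assumes f: "f \<in> G \<rightarrow> carrier A" and selfadjoint: "\<And>g. g \<in> G \<Longrightarrow> invol A (f g) = f g"
    and gens: "\<And>g h. g \<in> G \<Longrightarrow> h \<in> G \<Longrightarrow> f g \<otimes> f h = f h \<otimes> f g"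
    and "s \<in> terms_over G" "t \<in> terms_over G"
  shows "eval_term A f s \<otimes> eval_term A f t = eval_term A f t \<otimes> eval_term A f s"
proof -
  note [simp] = eval_closed[OF f] invol_closed scale_closed
  have fc [simp]: "f g \<in> carrier A" if "g \<in> G" for g using f that by auto
  have mult: "(x \<otimes> y) \<otimes> z = z \<otimes> (x \<otimes> y)" if "x \<otimes> z = z \<otimes> x" "y \<otimes> z = z \<otimes> y"
    "x \<in> carrier A" "y \<in> carrier A" "z \<in> carrier A" for x y z
  proof -
    have "(x \<otimes> y) \<otimes> z = (x \<otimes> z) \<otimes> y" using that(2-) by (simp add: m_assoc)
    also have "\<dots> = (z \<otimes> x) \<otimes> y" by (simp only: that(1))
    also have "\<dots> = z \<otimes> (x \<otimes> y)" using that(3-) by (simp add: m_assoc)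
    finally show ?thesis .
  qed
  have gen: "eval_term A f t \<otimes> f g = f g \<otimes> eval_term A f t" if "t \<in> terms_over G" "g \<in> G" for t g
    using that(1)
  proof (induction t)
    case (Star t)
    have "eval_term A f (Star t) \<otimes> f g = invol A (f g \<otimes> eval_term A f t)"
      using Star.prems that(2) by (simp add: invol_mult selfadjoint)
    also have "f g \<otimes> eval_term A f t = eval_term A f t \<otimes> f g" using Star by simp
    finally show ?case using Star.prems that(2) by (simp add: invol_mult selfadjoint)
  next
    case (Mult s t)
    then have "s \<in> terms_over G" "t \<in> terms_over G" by simp_all
    then show ?case unfolding eval_term.simps
      by (intro mult Mult.IH) (simp_all add: that(2))
  qed (use that(2) gens in \<open>simp_all add: l_distr r_distr flip: scale_mult_left scale_mult_right\<close>)
  show ?thesis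
    using assms(4,5)
  proof (induction s arbitrary: t)
    case (Gen g)
    then show ?case using gen by simp
  next
    \<comment> \<open>Taking adjoints moves the star to the other term, so the induction hypothesis
      is used at \<open>Star t\<close>; hence \<open>t\<close> is generalised.\<close>
    case (Star s)
    have "eval_term A f (Star s) \<otimes> eval_term A f t = invol A (eval_term A f (Star t) \<otimes> eval_term A f s)"
      using Star.prems by (simp add: invol_mult invol_invol)
    also have "eval_term A f (Star t) \<otimes> eval_term A f s = eval_term A f s \<otimes> eval_term A f (Star t)"
      using Star.IH[of "Star t"] Star.prems by simp
    finally show ?case using Star.prems by (simp add: invol_mult invol_invol)
  next
    case (Mult s s')
    then have "s \<in> terms_over G" "s' \<in> terms_over G" by simp_all
    then show ?case unfolding eval_term.simps
      by (intro mult Mult.IH) (simp_all add: Mult.prems)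
  qed (simp_all add: l_distr r_distr flip: scale_mult_left scale_mult_right)
qed

end

text \<open>Every element of the universal algebra is thus a value of \<open>eval_term\<close> at
  the generators, which is the form that \<open>eval_terms_commute\<close> treats.\<close>

lemma eval_universal:
  assumes "t \<in> terms_over G"
  shows "eval_term (universal_star_algebra G R) (\<lambda>g. star_class G R (Gen g)) t = star_class G R t"
  using assms by (induction t) (simp_all add: usa_ops)

lemma commutative_qaut_algebraI:
  assumes fin: "finite (pverts X)"
    and gens: "\<And>i j k l. \<lbrakk>i \<in> pverts X; j \<in> pverts X; k \<in> pverts X; l \<in> pverts X\<rbrakk> \<Longrightarrow>
      qaut_gen X i j \<otimes>\<^bsub>qaut_algebra X\<^esub> qaut_gen X k l = qaut_gen X k l \<otimes>\<^bsub>qaut_algebra X\<^esub> qaut_gen X i j"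
  shows "commutative_alg (qaut_algebra X)"
proof -
  interpret star_algebra "qaut_algebra X" by (rule qaut_star_algebra)
  let ?G = "pverts X \<times> pverts X" and ?R = "qaut_relations X"
  let ?f = "\<lambda>g. star_class ?G ?R (Gen g)"
  have f: "?f g \<in> carrier (qaut_algebra X)" "invol (qaut_algebra X) (?f g) = ?f g" if "g \<in> ?G" for g
    using qaut_gen_is_qaut_matrix[OF fin] that unfolding is_qaut_matrix_def Let_def qaut_gen_def by auto
  have "eval_term (qaut_algebra X) ?f s \<otimes>\<^bsub>qaut_algebra X\<^esub> eval_term (qaut_algebra X) ?f t =
      eval_term (qaut_algebra X) ?f t \<otimes>\<^bsub>qaut_algebra X\<^esub> eval_term (qaut_algebra X) ?f s"
    if "s \<in> terms_over ?G" "t \<in> terms_over ?G" for s t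
  proof (rule eval_terms_commute[OF _ _ _ that])
    show "?f g \<otimes>\<^bsub>qaut_algebra X\<^esub> ?f h = ?f h \<otimes>\<^bsub>qaut_algebra X\<^esub> ?f g" if "g \<in> ?G" "h \<in> ?G" for g h
      using gens[of "fst g" "snd g" "fst h" "snd h"] that by (auto simp: qaut_gen_def)
  qed (use f in auto)
  then show ?thesis
    by (auto simp: commutative_alg_def qaut_algebra_def usa_carrier eval_universal)
qed

section \<open>The geometry of the elliptic quadric\<close>

text \<open>Vectors over the two-element field as Boolean tuples, a form that can be evaluated:
  inequality is addition and conjunction is multiplication.\<close>

type_synonym bits6 = "bool \<times> bool \<times> bool \<times> bool \<times> bool \<times> bool"

definition zero6 :: bits6 where
  "zero6 = (False, False, False, False, False, False)"

fun add6 :: "bits6 \<Rightarrow> bits6 \<Rightarrow> bits6" where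
  "add6 (a, b, c, d, e, f) (a', b', c', d', e', f') =
    (a \<noteq> a', b \<noteq> b', c \<noteq> c', d \<noteq> d', e \<noteq> e', f \<noteq> f')"

text \<open>The disjunction is the anisotropic form \<open>Q_e\<close>, which vanishes only at
  zero.\<close>

fun quad6 :: "bits6 \<Rightarrow> bool" where
  "quad6 (a, b, c, d, e, f) \<longleftrightarrow> (((a \<and> b) \<noteq> (c \<and> d)) \<noteq> (e \<or> f))"

fun polar6 :: "bits6 \<Rightarrow> bits6 \<Rightarrow> bool" where
  "polar6 (a, b, c, d, e, f) (a', b', c', d', e', f') \<longleftrightarrow>
    (((a \<and> b') \<noteq> (b \<and> a')) \<noteq> (((c \<and> d') \<noteq> (d \<and> c')) \<noteq> ((e \<and> f') \<noteq> (f \<and> e'))))"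

definition singular6 :: "bits6 list" where
  "singular6 = filter (\<lambda>v. v \<noteq> zero6 \<and> \<not> quad6 v)
    (let B = [False, True] in
      List.product B (List.product B (List.product B (List.product B (List.product B B)))))"

definition orth6 :: "bits6 \<Rightarrow> bits6 list \<Rightarrow> bits6 list" where
  "orth6 v P = filter (\<lambda>w. w \<noteq> v \<and> \<not> polar6 v w) P"

text \<open>The vector \<open>v\<close> itself drops out, because the polar form is
  alternating.\<close>

definition opp6 :: "bits6 \<Rightarrow> bits6 list \<Rightarrow> bits6 list" where
  "opp6 v P = filter (polar6 v) P"

text \<open>
  The two checks are phrased by nested filters, with the filtered lists passed as arguments, so
  that the code simplifier computes every list only once.
\<close>

definition triangles_at6 :: "bits6 \<Rightarrow> bits6 list \<Rightarrow> bool" where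
  "triangles_at6 v N \<longleftrightarrow> list_all (\<lambda>w. orth6 w N = [add6 v w]) N"

definition triangles6 :: "bits6 list \<Rightarrow> bool" where
  "triangles6 P \<longleftrightarrow> list_all (\<lambda>v. triangles_at6 v (orth6 v P)) P"

text \<open>In use, \<open>F\<close> lists the non-neighbours of a point \<open>v\<close>, and
  \<open>C\<close> the common neighbours of \<open>v\<close> and \<open>w\<close>. The point
  \<open>w\<close> is then the only non-neighbour of \<open>v\<close> orthogonal to all of
  \<open>C\<close>.\<close>

definition separated_pair6 :: "bits6 list \<Rightarrow> bits6 \<Rightarrow> bits6 list \<Rightarrow> bool" where
  "separated_pair6 F w C \<longleftrightarrow> filter (\<lambda>p. list_all (\<lambda>s. \<not> polar6 s p) C) F = [w]"

definition separated_at6 :: "bits6 list \<Rightarrow> bits6 list \<Rightarrow> bool" where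
  "separated_at6 N F \<longleftrightarrow> list_all (\<lambda>w. separated_pair6 F w (orth6 w N)) F"

definition separated6 :: "bits6 list \<Rightarrow> bool" where
  "separated6 P \<longleftrightarrow> list_all (\<lambda>v. separated_at6 (orth6 v P) (opp6 v P)) P"

lemma triangles6_singular6: "triangles6 singular6"
  by code_simp

lemma separated6_singular6: "separated6 singular6"
  by code_simp

section \<open>Translation between \<open>bit ^ 6\<close> and Boolean tuples\<close>

lemma UNIV_6: "(UNIV :: 6 set) = {0, 1, 2, 3, 4, 5}"
proof (rule HOL.sym, rule card_subset_eq)
  show "card {0, 1, 2, 3, 4, 5 :: 6} = card (UNIV :: 6 set)" by simp
qed simp_all

lemma forall_6: "(\<forall>i::6. P i) \<longleftrightarrow> P 0 \<and> P 1 \<and> P 2 \<and> P 3 \<and> P 4 \<and> P 5"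
proof -
  have "(\<forall>i::6. P i) \<longleftrightarrow> (\<forall>i\<in>UNIV. P i)" by simp
  then show ?thesis unfolding UNIV_6 by simp
qed

text \<open>The polarization of \<open>Q_form\<close>, bracketed as in \<open>polar6\<close> so that
  the translation is plain rewriting.\<close>

definition polar :: "bit ^ 6 \<Rightarrow> bit ^ 6 \<Rightarrow> bit" where
  "polar v w = v $ 0 * w $ 1 + v $ 1 * w $ 0 + (v $ 2 * w $ 3 + v $ 3 * w $ 2 + (v $ 4 * w $ 5 + v $ 5 * w $ 4))"

lemma Q_form_add: "Q_form (v + w) = Q_form v + Q_form w + polar v w"
proof -
  \<comment> \<open>The form splits over three coordinate planes, and the hyperbolic and the
    elliptic plane have the same polar form.\<close>
  have hyp: "(a + a') * (b + b') = a * b + a' * b' + (a * b' + b * a')" for a b a' b' :: bit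
    by (cases a; cases b; cases a'; cases b') simp_all
  have ell: "Q_e (a + a') (b + b') = Q_e a b + Q_e a' b' + (a * b' + b * a')" for a b a' b'
    by (cases a; cases b; cases a'; cases b') (simp_all add: Q_e_def)
  show ?thesis
    unfolding Q_form_def polar_def vector_add_component hyp ell by (simp only: ac_simps)
qed

text \<open>Over the two-element field a point contains just one nonzero vector, so these vectors
  stand for the vertices.\<close>

definition singular :: "(bit ^ 6) set" where
  "singular = {v. v \<noteq> 0 \<and> Q_form v = 0}"

definition bits :: "bit ^ 6 \<Rightarrow> bits6" where
  "bits v = (v $ 0 = 1, v $ 1 = 1, v $ 2 = 1, v $ 3 = 1, v $ 4 = 1, v $ 5 = 1)"

lemma bit_eq_one_simps:
  fixes a b :: bit
  shows "a + b = 1 \<longleftrightarrow> (a = 1) \<noteq> (b = 1)" "a * b = 1 \<longleftrightarrow> a = 1 \<and> b = 1"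
  by (cases a; cases b; simp)+

lemma bit_eq_iff_one: "a = b \<longleftrightarrow> (a = 1 \<longleftrightarrow> b = 1)" for a b :: bit
  by (cases a; cases b; simp)

lemma bits_eq_iff: "bits v = bits w \<longleftrightarrow> v = w"
  using bit_eq_iff_one[of "v $ i" "w $ i" for i]
  unfolding bits_def vec_eq_iff forall_6 prod.inject by blast

lemma bits_zero: "bits 0 = zero6"
  by (simp add: bits_def zero6_def)

lemma bits_add: "bits (v + w) = add6 (bits v) (bits w)"
  by (simp add: bits_def bit_eq_one_simps)

lemma polar6_bits: "polar6 (bits v) (bits w) \<longleftrightarrow> polar v w = 1"
  by (simp only: bits_def polar_def bit_eq_one_simps polar6.simps)

lemma quad6_bits: "quad6 (bits v) \<longleftrightarrow> Q_form v = 1"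
proof -
  have "Q_e a b = 1 \<longleftrightarrow> a = 1 \<or> b = 1" for a b
    by (cases a; cases b) (simp_all add: Q_e_def)
  then show ?thesis
    by (simp only: bits_def Q_form_def bit_eq_one_simps quad6.simps)
qed

lemma bits_surj: "\<exists>v. bits v = x"
proof -
  obtain a b c d e f where x: "x = (a, b, c, d, e, f)" by (cases x) auto
  show ?thesis
    by (rule exI[of _ "\<chi> i. of_bool (if i = 0 then a else if i = 1 then b else if i = 2 then c
      else if i = 3 then d else if i = 4 then e else f)"]) (simp add: bits_def x)
qed

lemma set_singular6: "set singular6 = bits ` singular"
proof -
  have "set [False, True] = UNIV" by auto
  then have "x \<in> set singular6 \<longleftrightarrow> x \<noteq> zero6 \<and> \<not> quad6 x" for x
    by (simp only: singular6_def Let_def set_filter set_product UNIV_Times_UNIV mem_Collect_eq UNIV_I simp_thms)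
  moreover have "bits v \<noteq> zero6 \<and> \<not> quad6 (bits v) \<longleftrightarrow> v \<in> singular" for v
    by (simp add: singular_def quad6_bits bits_eq_iff flip: bits_zero)
  ultimately have mem: "bits v \<in> set singular6 \<longleftrightarrow> v \<in> singular" for v by blast
  show ?thesis
  proof (intro equalityI subsetI)
    fix x assume x: "x \<in> set singular6"
    obtain v where "x = bits v" using bits_surj by metis
    then show "x \<in> bits ` singular" using x mem by blast
  next
    fix x assume "x \<in> bits ` singular"
    then show "x \<in> set singular6" using mem by blast
  qed
qed

text \<open>Transports \<open>triangles6_singular6\<close> along the injective map
  \<open>bits\<close>. The vector \<open>v + w\<close> is the third point of the totally singular
  line through \<open>v\<close> and \<open>w\<close>.\<close>

lemma polar_third_point:
  assumes "v \<in> singular" "w \<in> singular" "w \<noteq> v" "polar v w = 0"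
  shows "{x \<in> singular. x \<noteq> v \<and> x \<noteq> w \<and> polar v x = 0 \<and> polar w x = 0} = {v + w}"
proof -
  have v: "bits v \<in> set singular6" and w: "bits w \<in> set (orth6 (bits v) singular6)"
    using assms by (auto simp: set_singular6 orth6_def polar6_bits bits_eq_iff)
  have "orth6 (bits w) (orth6 (bits v) singular6) = [add6 (bits v) (bits w)]"
    using triangles6_singular6 v w by (auto simp: triangles6_def triangles_at6_def list_all_iff)
  then have "set (orth6 (bits w) (orth6 (bits v) singular6)) = {bits (v + w)}"
    by (simp add: bits_add)
  moreover have "set (orth6 (bits w) (orth6 (bits v) singular6))
      = bits ` {x \<in> singular. x \<noteq> v \<and> x \<noteq> w \<and> polar v x = 0 \<and> polar w x = 0}"
    by (auto simp: orth6_def set_singular6 polar6_bits bits_eq_iff)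
  ultimately have "bits ` {x \<in> singular. x \<noteq> v \<and> x \<noteq> w \<and> polar v x = 0 \<and> polar w x = 0} = bits ` {v + w}"
    by simp
  moreover have "inj bits" by (simp add: inj_def bits_eq_iff)
  ultimately show ?thesis by (simp only: inj_image_eq_iff)
qed

text \<open>By \<open>separated6_singular6\<close> only \<open>w\<close> passes the filter, so
  \<open>p\<close> fails it at some common neighbour of \<open>v\<close> and
  \<open>w\<close>.\<close>

lemma polar_separated:
  assumes "v \<in> singular" "w \<in> singular" "p \<in> singular" "polar v w = 1" "polar v p = 1" "p \<noteq> w"
  shows "\<exists>s\<in>singular. s \<noteq> v \<and> s \<noteq> w \<and> polar v s = 0 \<and> polar w s = 0 \<and> polar s p = 1"
proof -
  let ?F = "opp6 (bits v) singular6" and ?C = "orth6 (bits w) (orth6 (bits v) singular6)"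
  have v: "bits v \<in> set singular6" and w: "bits w \<in> set ?F" and p: "bits p \<in> set ?F"
    using assms by (auto simp: set_singular6 opp6_def polar6_bits)
  have "filter (\<lambda>p. list_all (\<lambda>s. \<not> polar6 s p) ?C) ?F = [bits w]"
    using separated6_singular6 v w
    by (auto simp: separated6_def separated_at6_def separated_pair6_def list_all_iff)
  then have "bits p \<notin> set (filter (\<lambda>p. list_all (\<lambda>s. \<not> polar6 s p) ?C) ?F)"
    using assms(6) by (simp add: bits_eq_iff)
  then obtain x where "x \<in> set ?C" "polar6 x (bits p)"
    using p by (auto simp: list_all_iff)
  then show ?thesis
    by (auto simp: orth6_def set_singular6 polar6_bits bits_eq_iff)
qed

section \<open>Edges, triangles and separating vertices of the graph\<close>

lemma span_singleton_inj: "v \<noteq> 0 \<Longrightarrow> w \<noteq> 0 \<Longrightarrow> vec.span {v} = vec.span {w} \<longleftrightarrow> v = w" for v w :: "bit ^ 6"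
  unfolding span_bit by (auto simp: doubleton_eq_iff)

lemma pverts_O_minus_6_2: "pverts O_minus_6_2 = (\<lambda>v. vec.span {v}) ` singular"
  by (auto simp: O_minus_6_2_def singular_def)

lemma parcs_O_minus_6_2_iff:
  assumes "v \<in> singular" "w \<in> singular"
  shows "(vec.span {v}, vec.span {w}) \<in> parcs O_minus_6_2 \<longleftrightarrow> v \<noteq> w \<and> polar v w = 0"
proof
  assume "(vec.span {v}, vec.span {w}) \<in> parcs O_minus_6_2"
  then obtain v' w' where "vec.span {v} = vec.span {v'}" "vec.span {w} = vec.span {w'}"
    and "v' \<in> singular" "w' \<in> singular" "vec.span {v'} \<noteq> vec.span {w'}" "Q_form (v' + w') = 0"
    by (auto simp: O_minus_6_2_def singular_def)
  \<comment> \<open>The edge set is given by arbitrary spanning vectors; equal spans force these to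
    be the given ones.\<close>
  moreover from this have "v' = v" "w' = w"
    using assms by (auto simp: singular_def span_singleton_inj)
  ultimately show "v \<noteq> w \<and> polar v w = 0"
    using assms by (auto simp: singular_def Q_form_add)
next
  assume vw: "v \<noteq> w \<and> polar v w = 0"
  then have "Q_form (v + w) = 0" using assms by (simp add: singular_def Q_form_add)
  then show "(vec.span {v}, vec.span {w}) \<in> parcs O_minus_6_2"
    using vw assms span_singleton_inj[of v w] unfolding O_minus_6_2_def singular_def by auto
qed

lemma O_minus_6_2_unique_triangle:
  assumes "(i, k) \<in> parcs O_minus_6_2"
  shows "\<exists>!t. (i, t) \<in> parcs O_minus_6_2 \<and> (k, t) \<in> parcs O_minus_6_2"
proof -
  interpret pair_graph O_minus_6_2 by (rule pair_graph_O_minus_6_2)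
  have "i \<in> pverts O_minus_6_2" "k \<in> pverts O_minus_6_2"
    using assms by (auto dest: in_arcsD1 in_arcsD2)
  then obtain v w where vw: "v \<in> singular" "w \<in> singular" and ik: "i = vec.span {v}" "k = vec.span {w}"
    by (auto simp: pverts_O_minus_6_2)
  then have x: "{x \<in> singular. x \<noteq> v \<and> x \<noteq> w \<and> polar v x = 0 \<and> polar w x = 0} = {v + w}"
    using assms by (intro polar_third_point) (auto simp: parcs_O_minus_6_2_iff)
  show ?thesis
  proof (rule ex1I[of _ "vec.span {v + w}"])
    have "v + w \<in> singular" "v + w \<noteq> v" "v + w \<noteq> w" "polar v (v + w) = 0" "polar w (v + w) = 0"
      using x by blast+
    then show "(i, vec.span {v + w}) \<in> parcs O_minus_6_2 \<and> (k, vec.span {v + w}) \<in> parcs O_minus_6_2"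
      using vw unfolding ik by (simp only: parcs_O_minus_6_2_iff) simp
  next
    fix t assume t: "(i, t) \<in> parcs O_minus_6_2 \<and> (k, t) \<in> parcs O_minus_6_2"
    then have "t \<in> pverts O_minus_6_2" by (auto dest: in_arcsD2)
    then obtain y where y: "y \<in> singular" "t = vec.span {y}" by (auto simp: pverts_O_minus_6_2)
    then have "y \<in> {x \<in> singular. x \<noteq> v \<and> x \<noteq> w \<and> polar v x = 0 \<and> polar w x = 0}"
      using t vw unfolding ik y(2) by (auto simp: parcs_O_minus_6_2_iff)
    then show "t = vec.span {v + w}" unfolding x y(2) by simp
  qed
qed

lemma polar_commute: "polar v w = polar w v"
  by (simp only: polar_def ac_simps)

lemma O_minus_6_2_separated:
  assumes "j \<in> pverts O_minus_6_2" "l \<in> pverts O_minus_6_2" "p \<in> pverts O_minus_6_2"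
    and "j \<noteq> l" "p \<noteq> l" "p \<noteq> j" "(j, l) \<notin> parcs O_minus_6_2" "(p, l) \<notin> parcs O_minus_6_2"
  shows "\<exists>s. (s, j) \<in> parcs O_minus_6_2 \<and> (s, l) \<in> parcs O_minus_6_2 \<and> (s, p) \<notin> parcs O_minus_6_2"
proof -
  obtain v w q where S: "v \<in> singular" "w \<in> singular" "q \<in> singular"
    and e: "l = vec.span {v}" "j = vec.span {w}" "p = vec.span {q}"
    using assms(1-3) by (auto simp: pverts_O_minus_6_2)
  \<comment> \<open>Both non-edges contain \<open>l\<close>, so \<open>l\<close> is the base point
    \<open>v\<close>; a nonzero bit is \<open>1\<close>.\<close>
  have "polar v w = 1" "polar v q = 1" "q \<noteq> w"
    using assms(4-) S unfolding e by (auto simp: parcs_O_minus_6_2_iff polar_commute[of v])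
  then obtain s where s: "s \<in> singular" "s \<noteq> v" "s \<noteq> w" "polar v s = 0" "polar w s = 0" "polar s q = 1"
    using polar_separated S by blast
  then show ?thesis
    using S unfolding e
    by (intro exI[of _ "vec.span {s}"]) (simp add: parcs_O_minus_6_2_iff polar_commute[of s v] polar_commute[of s w])
qed

section \<open>Commutativity for the graph and its complement\<close>

lemma qaut_matrix_O_minus_6_2_commute:
  assumes B: "star_algebra B" and u: "is_qaut_matrix O_minus_6_2 B u"
    and V: "i \<in> pverts O_minus_6_2" "j \<in> pverts O_minus_6_2" "k \<in> pverts O_minus_6_2" "l \<in> pverts O_minus_6_2"
  shows "u i j \<otimes>\<^bsub>B\<^esub> u k l = u k l \<otimes>\<^bsub>B\<^esub> u i j"
proof -
  interpret unique_triangle_quantum_automorphism B O_minus_6_2 u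
    by (intro unique_triangle_quantum_automorphism.intro quantum_automorphism.intro
        quantum_automorphism_axioms.intro unique_triangle_quantum_automorphism_axioms.intro
        B u pair_graph_O_minus_6_2 O_minus_6_2_unique_triangle)
  show ?thesis by (rule commute[OF O_minus_6_2_separated V])
qed

theorem theorem4p3:
  shows "commutative_alg (qaut_algebra O_minus_6_2) \<and> no_quantum_symmetry schlafli_graph"
proof
  interpret O: pair_graph O_minus_6_2 by (rule pair_graph_O_minus_6_2)
  note fin = O.pair_finite_verts
  show "commutative_alg (qaut_algebra O_minus_6_2)"
  proof (rule commutative_qaut_algebraI[OF fin])
    show "qaut_gen O_minus_6_2 i j \<otimes>\<^bsub>qaut_algebra O_minus_6_2\<^esub> qaut_gen O_minus_6_2 k l
        = qaut_gen O_minus_6_2 k l \<otimes>\<^bsub>qaut_algebra O_minus_6_2\<^esub> qaut_gen O_minus_6_2 i j"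
      if "i \<in> pverts O_minus_6_2" "j \<in> pverts O_minus_6_2" "k \<in> pverts O_minus_6_2" "l \<in> pverts O_minus_6_2"
      for i j k l
      by (rule qaut_matrix_O_minus_6_2_commute[OF qaut_star_algebra qaut_gen_is_qaut_matrix[OF fin] that])
  qed
  have V: "pverts schlafli_graph = pverts O_minus_6_2"
    by (simp add: schlafli_graph_def graph_complement_def)
  have "is_qaut_matrix (graph_complement O_minus_6_2) (qaut_algebra schlafli_graph) (qaut_gen schlafli_graph)"
    using qaut_gen_is_qaut_matrix[of schlafli_graph] fin unfolding V
    by (simp only: schlafli_graph_def)
  \<comment> \<open>The generators for the Schlaefli graph also satisfy the relations of
    \<open>O_minus_6_2\<close>, inside their own algebra, so the commutation result for arbitrary
    star algebras applies to them.\<close>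
  note u = is_qaut_matrix_complement[OF qaut_star_algebra pair_graph_O_minus_6_2 this]
  have "commutative_alg (qaut_algebra schlafli_graph)"
  proof (rule commutative_qaut_algebraI)
    show "qaut_gen schlafli_graph i j \<otimes>\<^bsub>qaut_algebra schlafli_graph\<^esub> qaut_gen schlafli_graph k l
        = qaut_gen schlafli_graph k l \<otimes>\<^bsub>qaut_algebra schlafli_graph\<^esub> qaut_gen schlafli_graph i j"
      if "i \<in> pverts schlafli_graph" "j \<in> pverts schlafli_graph" "k \<in> pverts schlafli_graph" "l \<in> pverts schlafli_graph"
      for i j k l
      by (rule qaut_matrix_O_minus_6_2_commute[OF qaut_star_algebra u that[unfolded V]])
  qed (simp add: V fin)
  then show "no_quantum_symmetry schlafli_graph"
    unfolding no_quantum_symmetry_def .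
qed

end
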